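(* Consider the semi-discrete finite volume scheme $$\frac{d\mathbf{q}^{\ell}}{dt}=-\sum_{\Omega^{r}\in\mathcal{N}_\ell}\frac{|\partial\Omega^{\ell r}|}{|\Omega^\ell|}\,\mathbf{f}^{\ell r}$$ for the Maxwell-GLM system, where the numerical flux $\mathbf{f}^{\ell r}$ satisfies, on every face, the discrete compatibility condition $$\mathbf{p}^\ell\cdot\big(\mathbf{f}^{\ell r}-\mathbf{f}_k^\ell n_k^{\ell r}\big)+\mathbf{p}^r\cdot\big(\mathbf{f}_k^rn_k^{\ell r}-\mathbf{f}^{\ell r}\big)=\big(F_k^r-F_k^\ell\big)n_k^{\ell r}.$$ Then the scheme conserves total energy in the sense that, for vanishing boundary fluxes, $$\int_\Omega\frac{\partial\mathcal{E}}{\partial t}\,\mathrm{d}\mathbf{x}=\sum_\ell|\Omega^\ell|\,\frac{d}{dt}\mathcal{E}(\mathbf{q}^\ell)=0 .$$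
   Context: The Maxwell-GLM system, with constants $c_0,c_h>0$, is $\partial_t\mathbf{B}+c_0\nabla\times\mathbf{E}+c_h\nabla\phi=0$, $\partial_t\phi+c_h\nabla\cdot\mathbf{B}=0$, $\partial_t\mathbf{E}-c_0\nabla\times\mathbf{B}+c_h\nabla\psi=0$, $\partial_t\psi+c_h\nabla\cdot\mathbf{E}=0$. It is written compactly as $\partial_t\mathbf{q}+\partial_k\mathbf{f}_k(\mathbf{q})=0$ (summation over repeated $k$) with $\mathbf{q}=(\mathbf{B},\phi,\mathbf{E},\psi)\in\mathbb{R}^8$, and has the extra conservation law $\partial_t\mathcal{E}+\partial_kF_k=0$ with total energy density $\mathcal{E}=\frac12(|\mathbf{E}|^2+|\mathbf{B}|^2+\psi^2+\phi^2)$ and energy flux $F_k$ the $k$-th component of $c_0\mathbf{E}\times\mathbf{B}+c_h(\psi\mathbf{E}+\phi\mathbf{B})$. The dual variables are $\mathbf{p}=\partial\mathcal{E}/\partial\mathbf{q}$ ($=\mathbf{q}$ here), and $\mathbf{p}\cdot\partial_k\mathbf{f}_k(\mathbf{q})=\partial_kF_k$. Mesh: the domain $\Omega\subset\mathbb{R}^d$ is paved by finitely many polygonal/polyhedral control volumes $\Omega^\ell$ (Cartesian cells in the paper) of volume $|\Omega^\ell|$; $\mathcal{N}_\ell$ is the set of neighbours of $\Omega^\ell$; $\partial\Omega^{\ell r}$ is the common face of $\Omega^\ell$ and $\Omega^r$, of measure $|\partial\Omega^{\ell r}|$, with unit normal $\mathbf{n}^{\ell r}=(n_k^{\ell r})$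 pointing from $\Omega^\ell$ to $\Omega^r$, so $\mathbf{n}^{r\ell}=-\mathbf{n}^{\ell r}$; the cell boundaries are closed, so $\sum_{\Omega^r\in\mathcal{N}_\ell}|\partial\Omega^{\ell r}|\mathbf{n}^{\ell r}=0$. Faces on $\partial\Omega$ are included, the neighbour there being an exterior (ghost) cell carrying some state $\mathbf{q}^r$. A superscript $\ell$ or $r$ denotes evaluation at the cell state: $\mathbf{p}^\ell=\mathbf{p}(\mathbf{q}^\ell)$, $\mathbf{f}_k^\ell=\mathbf{f}_k(\mathbf{q}^\ell)$, $F_k^\ell=F_k(\mathbf{q}^\ell)$. The numerical flux in normal direction is single-valued on each face: $\mathbf{f}^{r\ell}=-\mathbf{f}^{\ell r}$. "Vanishing boundary fluxes" means that on every face lying on $\partial\Omega$ the numerical total energy flux $F^{\ell r}=\frac12\big((F_k^r+F_k^\ell)n_k^{\ell r}-(\mathbf{p}^r\cdot\mathbf{f}_k^r+\mathbf{p}^\ell\cdot\mathbf{f}_k^\ell)n_k^{\ell r}+(\mathbf{p}^r+\mathbf{p}^\ell)\cdot\mathbf{f}^{\ell r}\big)$ equals zero. *)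

theory Defs
  imports "HOL-Analysis.Analysis"
begin

section \<open>The Maxwell-GLM system\<close>

text \<open>The state \<open>q = (B, \<phi>, E, \<psi>)\<close>. The product inner product is the Euclidean one on the
  eight components.\<close>

type_synonym state = "(real^3) \<times> real \<times> (real^3) \<times> real"

text \<open>Since \<open>\<nabla> \<times> E = (\<Sum>k. e\<^sub>k \<times> \<partial>\<^sub>k E)\<close>, the flux in direction \<open>k\<close> involves \<open>e\<^sub>k \<times> E\<close> and
  \<open>e\<^sub>k \<times> B\<close>; see \<open>flux_divergence\<close> below.\<close>

fun flux :: "real \<Rightarrow> real \<Rightarrow> 3 \<Rightarrow> state \<Rightarrow> state" where
  "flux c0 ch k (B, \<phi>, E, \<psi>) =
     (c0 *\<^sub>R cross3 (axis k 1) E + (ch * \<phi>) *\<^sub>R axis k 1,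
      ch * B $ k,
      - (c0 *\<^sub>R cross3 (axis k 1) B) + (ch * \<psi>) *\<^sub>R axis k 1,
      ch * E $ k)"

fun energy :: "state \<Rightarrow> real" where
  "energy (B, \<phi>, E, \<psi>) = ((norm E)\<^sup>2 + (norm B)\<^sup>2 + \<psi>\<^sup>2 + \<phi>\<^sup>2) / 2"

fun energy_flux :: "real \<Rightarrow> real \<Rightarrow> 3 \<Rightarrow> state \<Rightarrow> real" where
  "energy_flux c0 ch k (B, \<phi>, E, \<psi>) =
     (c0 *\<^sub>R cross3 E B + ch *\<^sub>R (\<psi> *\<^sub>R E + \<phi> *\<^sub>R B)) $ k"

definition dual_var :: "state \<Rightarrow> state" where
  "dual_var q = (THE p. GDERIV energy q :> p)"

lemma energy_inner: "energy q = (q \<bullet> q) / 2"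
  by (cases q) (simp add: power2_norm_eq_inner, simp add: power2_eq_square)

lemma GDERIV_energy: "GDERIV energy q :> q"
proof -
  have "energy = (\<lambda>q. (q \<bullet> q) / 2)"
    by (rule ext) (rule energy_inner)
  moreover have "((\<lambda>q::state. (q \<bullet> q) / 2) has_derivative (\<lambda>h. h \<bullet> q)) (at q)"
    by (auto intro!: derivative_eq_intros simp: inner_commute)
  ultimately show ?thesis
    by (simp add: gderiv_def)
qed

lemma dual_var_eq: "dual_var q = q"
  unfolding dual_var_def
proof (rule the_equality[where a = q])
  fix p assume "GDERIV energy q :> p"
  with GDERIV_energy[of q] have "(\<lambda>h. h \<bullet> p) = (\<lambda>h. h \<bullet> q)"
    unfolding gderiv_def by (rule has_derivative_unique[rotated])
  then have "(p - q) \<bullet> p = (p - q) \<bullet> q"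
    by meson
  then have "(p - q) \<bullet> (p - q) = 0"
    by (simp add: inner_diff_right)
  then show "p = q"
    by simp
qed (rule GDERIV_energy)

text \<open>With \<open>dB k\<close>, \<open>d\<phi> k\<close>, \<open>dE k\<close>, \<open>d\<psi> k\<close> in the role of the partial derivatives in direction
  \<open>k\<close>, the divergence of the (linear) flux is the spatial part of the Maxwell-GLM system.\<close>

lemma flux_divergence:
  fixes dB dE :: "3 \<Rightarrow> real^3" and d\<phi> d\<psi> :: "3 \<Rightarrow> real"
  defines "curl \<equiv> \<lambda>dV :: 3 \<Rightarrow> real^3.
    vector [dV 2 $ 3 - dV 3 $ 2, dV 3 $ 1 - dV 1 $ 3, dV 1 $ 2 - dV 2 $ 1] :: real^3"
  shows "(\<Sum>k\<in>UNIV. flux c0 ch k (dB k, d\<phi> k, dE k, d\<psi> k)) =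
    (c0 *\<^sub>R curl dE + ch *\<^sub>R (\<chi> k. d\<phi> k),
     ch * (\<Sum>k\<in>UNIV. dB k $ k),
     - (c0 *\<^sub>R curl dB) + ch *\<^sub>R (\<chi> k. d\<psi> k),
     ch * (\<Sum>k\<in>UNIV. dE k $ k))"
  by (simp add: curl_def sum_3 vec_eq_iff forall_3 cross3_def axis_def algebra_simps)

text \<open>The compatibility \<open>p \<bullet> \<partial>\<^sub>k f\<^sub>k = \<partial>\<^sub>k F\<^sub>k\<close> of flux and energy flux.\<close>

lemma energy_flux_compat:
  fixes q :: "real \<Rightarrow> state"
  assumes "(q has_vector_derivative q') (at x)"
  shows "((\<lambda>x. energy_flux c0 ch k (q x)) has_real_derivative
          dual_var (q x) \<bullet> flux c0 ch k q') (at x)"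
proof -
  obtain B' \<phi>' E' \<psi>' where q': "q' = (B', \<phi>', E', \<psi>')"
    by (cases q') auto
  define B \<phi> E \<psi> where defs: "B = (\<lambda>x. fst (q x))" "\<phi> = (\<lambda>x. fst (snd (q x)))"
    "E = (\<lambda>x. fst (snd (snd (q x))))" "\<psi> = (\<lambda>x. snd (snd (snd (q x))))"
  have q: "q = (\<lambda>x. (B x, \<phi> x, E x, \<psi> x))"
    by (simp add: defs)
  have d: "(q has_derivative (\<lambda>h. h *\<^sub>R q')) (at x)"
    using assms by (simp add: has_vector_derivative_def)
  have "((\<lambda>x. B x $ i) has_derivative (\<lambda>h. h * B' $ i)) (at x)" for i
    using bounded_linear.has_derivative[OF bounded_linear_vec_nth has_derivative_fst[OF d], of i]
    by (simp add: defs q')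
  then have B: "((\<lambda>x. B x $ i) has_real_derivative B' $ i) (at x)" for i
    by (rule has_derivative_imp_has_field_derivative) simp
  have "((\<lambda>x. E x $ i) has_derivative (\<lambda>h. h * E' $ i)) (at x)" for i
    using bounded_linear.has_derivative[OF bounded_linear_vec_nth
        has_derivative_fst[OF has_derivative_snd[OF has_derivative_snd[OF d]]], of i]
    by (simp add: defs q')
  then have E: "((\<lambda>x. E x $ i) has_real_derivative E' $ i) (at x)" for i
    by (rule has_derivative_imp_has_field_derivative) simp
  have \<phi>: "(\<phi> has_real_derivative \<phi>') (at x)"
    unfolding defs
    by (rule has_derivative_imp_has_field_derivative[OF has_derivative_fst[OF has_derivative_snd[OF d]]])
      (simp add: q')
  have \<psi>: "(\<psi> has_real_derivative \<psi>') (at x)"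
    unfolding defs
    by (rule has_derivative_imp_has_field_derivative[OF has_derivative_snd[OF has_derivative_snd[OF has_derivative_snd[OF d]]]])
      (simp add: q')
  have gen: "((\<lambda>x. c0 * (E x $ i * B x $ j - E x $ j * B x $ i)
        + ch * (\<psi> x * E x $ k + \<phi> x * B x $ k)) has_real_derivative
      (c0 * ((E' $ i * B x $ j + B' $ j * E x $ i) - (E' $ j * B x $ i + B' $ i * E x $ j))
        + ch * ((\<psi>' * E x $ k + E' $ k * \<psi> x) + (\<phi>' * B x $ k + B' $ k * \<phi> x)))) (at x)" for i j k
    by (intro DERIV_add DERIV_diff DERIV_mult DERIV_cmult B E \<phi> \<psi>)
  consider "k = 1" | "k = 2" | "k = 3"
    using exhaust_3[of k] by blast
  then show ?thesis
  proof cases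
    case 1
    then show ?thesis
      using gen[of 2 3 1]
      by (simp add: dual_var_eq q q' cross3_def axis_def inner_vec_def sum_3 algebra_simps)
  next
    case 2
    then show ?thesis
      using gen[of 3 1 2]
      by (simp add: dual_var_eq q q' cross3_def axis_def inner_vec_def sum_3 algebra_simps)
  next
    case 3
    then show ?thesis
      using gen[of 1 2 3]
      by (simp add: dual_var_eq q q' cross3_def axis_def inner_vec_def sum_3 algebra_simps)
  qed
qed

text \<open>The space dimension is \<open>CARD('d)\<close>; \<open>dir\<close> names, for every coordinate of the mesh, the
  coordinate of the three-dimensional physical space it stands for. Fields do not vary in the
  remaining directions.\<close>

definition normal_flux :: "real \<Rightarrow> real \<Rightarrow> ('d::finite \<Rightarrow> 3) \<Rightarrow> real^'d \<Rightarrow> state \<Rightarrow> state" where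
  "normal_flux c0 ch dir n q = (\<Sum>k\<in>UNIV. n $ k *\<^sub>R flux c0 ch (dir k) q)"

definition normal_energy_flux :: "real \<Rightarrow> real \<Rightarrow> ('d::finite \<Rightarrow> 3) \<Rightarrow> real^'d \<Rightarrow> state \<Rightarrow> real" where
  "normal_energy_flux c0 ch dir n q = (\<Sum>k\<in>UNIV. n $ k * energy_flux c0 ch (dir k) q)"

definition num_energy_flux ::
    "real \<Rightarrow> real \<Rightarrow> ('d::finite \<Rightarrow> 3) \<Rightarrow> real^'d \<Rightarrow> state \<Rightarrow> state \<Rightarrow> state \<Rightarrow> real" where
  "num_energy_flux c0 ch dir n ql qr fnum =
     ((normal_energy_flux c0 ch dir n qr + normal_energy_flux c0 ch dir n ql)
      - (dual_var qr \<bullet> normal_flux c0 ch dir n qr + dual_var ql \<bullet> normal_flux c0 ch dir n ql)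
      + (dual_var qr + dual_var ql) \<bullet> fnum) / 2"


section \<open>Polyhedral meshes\<close>

text \<open>Finite unions of polytopes, all of affine dimension \<open>m\<close> (not necessarily convex).\<close>

definition polyhedral_set :: "int \<Rightarrow> ('a::euclidean_space) set \<Rightarrow> bool" where
  "polyhedral_set m S \<longleftrightarrow>
     (\<exists>P. finite P \<and> P \<noteq> {} \<and> (\<forall>C\<in>P. polytope C \<and> aff_dim C = m) \<and> S = \<Union>P)"

text \<open>The surface measure of a subset \<open>S\<close> of a hyperplane with unit normal \<open>n\<close>, expressed as the
  volume of the right prism of height 1 over \<open>S\<close>.\<close>

definition face_measure :: "'a::euclidean_space \<Rightarrow> 'a set \<Rightarrow> real" where
  "face_measure n S = measure lebesgue {x + s *\<^sub>R n | x s. x \<in> S \<and> 0 \<le> s \<and> s \<le> 1}"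

text \<open>\<open>L\<close> is the index set of the cells paving \<open>\<Omega>\<close>. A neighbour index \<open>r \<in> N l\<close> outside \<open>L\<close> stands
  for an exterior (ghost) cell; the corresponding face lies on the boundary of \<open>\<Omega>\<close>. In
  \<open>orientation\<close>, points common to faces of different directions (edges, vertices) have to be
  left out, hence the closure.\<close>

locale polyhedral_mesh =
  fixes \<Omega> :: "(real^'d::finite) set"
    and L :: "'c set"
    and cell :: "'c \<Rightarrow> (real^'d) set"
    and N :: "'c \<Rightarrow> 'c set"
    and face :: "'c \<Rightarrow> 'c \<Rightarrow> (real^'d) set"
    and normal :: "'c \<Rightarrow> 'c \<Rightarrow> real^'d"
  assumes finite_cells: "finite L"
    and cell_polyhedral: "l \<in> L \<Longrightarrow> polyhedral_set (int CARD('d)) (cell l)"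
    and paving: "\<Omega> = (\<Union>l\<in>L. cell l)"
    and cells_disjoint: "\<lbrakk>l \<in> L; r \<in> L; l \<noteq> r\<rbrakk> \<Longrightarrow> interior (cell l) \<inter> interior (cell r) = {}"
    and finite_neighbours: "l \<in> L \<Longrightarrow> finite (N l)"
    and neighbour_sym: "\<lbrakk>l \<in> L; r \<in> N l; r \<in> L\<rbrakk> \<Longrightarrow> l \<in> N r"
    and face_polyhedral: "\<lbrakk>l \<in> L; r \<in> N l\<rbrakk> \<Longrightarrow> polyhedral_set (int CARD('d) - 1) (face l r)"
    and face_planar: "\<lbrakk>l \<in> L; r \<in> N l; x \<in> face l r; y \<in> face l r\<rbrakk> \<Longrightarrow> normal l r \<bullet> (x - y) = 0"
    and face_sym: "\<lbrakk>l \<in> L; r \<in> N l\<rbrakk> \<Longrightarrow> face r l = face l r"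
    and face_inner: "\<lbrakk>l \<in> L; r \<in> N l; r \<in> L\<rbrakk> \<Longrightarrow> face l r \<subseteq> cell l \<inter> cell r"
    and face_boundary: "\<lbrakk>l \<in> L; r \<in> N l; r \<notin> L\<rbrakk> \<Longrightarrow> face l r \<subseteq> cell l \<inter> frontier \<Omega>"
    and faces_cover: "l \<in> L \<Longrightarrow> frontier (cell l) = (\<Union>r\<in>N l. face l r)"
    and faces_nonoverlapping: "\<lbrakk>l \<in> L; r \<in> N l; r' \<in> N l; r \<noteq> r'\<rbrakk> \<Longrightarrow>
          face_measure (normal l r) (face l r \<inter> face l r') = 0"
    and normal_unit: "\<lbrakk>l \<in> L; r \<in> N l\<rbrakk> \<Longrightarrow> norm (normal l r) = 1"
    and normal_antisym: "\<lbrakk>l \<in> L; r \<in> N l\<rbrakk> \<Longrightarrow> normal r l = - normal l r"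
    and orientation: "\<lbrakk>l \<in> L; r \<in> N l\<rbrakk> \<Longrightarrow>
          face l r \<subseteq> closure {x \<in> face l r. \<forall>\<^sub>F s in at_right 0.
            x - s *\<^sub>R normal l r \<in> interior (cell l) \<and>
            x + s *\<^sub>R normal l r \<in> (if r \<in> L then interior (cell r) else - \<Omega>)}"
    and boundary_closed: "l \<in> L \<Longrightarrow>
          (\<Sum>r\<in>N l. face_measure (normal l r) (face l r) *\<^sub>R normal l r) = 0"

text \<open>The piecewise constant field given by the cell states. The choice of the cell only matters on
  cell interfaces, a null set.\<close>

definition cellwise :: "'c set \<Rightarrow> ('c \<Rightarrow> 'a set) \<Rightarrow> ('c \<Rightarrow> real \<Rightarrow> state) \<Rightarrow> real \<Rightarrow> 'a \<Rightarrow> state" where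
  "cellwise L cell q t x = q (SOME l. l \<in> L \<and> x \<in> cell l) t"

end

theory Submission
  imports Defs
begin

text \<open>
  Why energy is conserved. Testing the scheme in the cell \<open>l\<close> with the dual variable \<open>p\<^sup>l\<close> gives, by
  the chain rule, \<open>|\<Omega>\<^sup>l| d\<E>/dt = - (\<Sum>r. |\<partial>\<Omega>\<^sup>l\<^sup>r| p\<^sup>l \<bullet> f\<^sup>l\<^sup>r)\<close>. Splitting \<open>p\<^sup>l\<close> into the mean
  \<open>(p\<^sup>l + p\<^sup>r) / 2\<close> and the half jump \<open>(p\<^sup>l - p\<^sup>r) / 2\<close>, the mean part is, up to terms in the two cell
  states, the numerical energy flux \<open>F\<^sup>l\<^sup>r\<close>, while the compatibility condition evaluates the jump part.
  The physical fluxes at the state of the other cell \<open>r\<close> cancel, and there remains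
  \<open>p\<^sup>l \<bullet> f\<^sup>l\<^sup>r = F\<^sup>l\<^sup>r + (p\<^sup>l \<bullet> f\<^sub>k\<^sup>l - F\<^sub>k\<^sup>l) n\<^sub>k\<^sup>l\<^sup>r\<close> (\<open>compatible_flux_work\<close>).

  The last term is linear in the normal with a coefficient that depends on \<open>l\<close> only, so that it
  vanishes after summation over the closed boundary of the cell (\<open>closed_boundary_work_zero\<close>).
  What is left is a finite volume scheme for the energy with the flux \<open>F\<^sup>l\<^sup>r\<close>. That flux is
  antisymmetric in \<open>l\<close> and \<open>r\<close>, hence inner faces cancel in pairs when all cells are summed up, and
  the outer faces do not contribute by assumption.

  The integral over \<open>\<Omega>\<close> is the weighted sum over the cells because the cells are bounded sets with
  disjoint interiors and negligible boundaries: any two of them share a null set only, on which the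
  integrand is irrelevant. Their volumes are positive, so that the factor \<open>|\<Omega>\<^sup>l|\<close> cancels the denominator in the
  scheme.
\<close>

section \<open>Measure of polyhedral cells and their faces\<close>

lemma polyhedral_set_compact:
  assumes "polyhedral_set m S"
  shows "compact S"
  using assms polytope_imp_compact compact_Union unfolding polyhedral_set_def by blast

lemma polyhedral_set_negligible_frontier:
  assumes "polyhedral_set m S"
  shows "negligible (frontier S)"
proof -
  obtain P where P: "finite P" "\<And>C. C \<in> P \<Longrightarrow> polytope C" "S = \<Union>P"
    using assms unfolding polyhedral_set_def by blast
  have "negligible (\<Union>C\<in>P. frontier C)"
    using P by (intro negligible_Union) (auto intro: negligible_convex_frontier polytope_imp_convex)
  then show ?thesis
    using P frontier_Union_subset[of P] by (metis negligible_subset)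
qed

text \<open>A full-dimensional convex set has interior points, and an open set is not negligible.\<close>

lemma polyhedral_set_measure_pos:
  fixes S :: "'a::euclidean_space set"
  assumes "polyhedral_set (int DIM('a)) S"
  shows "0 < measure lebesgue S"
proof -
  obtain C where C: "polytope C" "aff_dim C = int DIM('a)" "C \<subseteq> S"
    using assms unfolding polyhedral_set_def by blast
  have "C \<noteq> {}"
    using C(2) by (auto simp: aff_dim_empty)
  moreover have "affine hull C = UNIV"
    using C(2) by (simp add: aff_dim_eq_full)
  ultimately have "interior C \<noteq> {}"
    using polytope_imp_convex[OF C(1)] by (metis rel_interior_eq_empty rel_interior_interior)
  then have "\<not> negligible (interior C)"
    by (simp add: open_not_negligible)
  then have "\<not> negligible S"
    using C(3) interior_subset negligible_subset by (metis subset_trans)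
  moreover have "S \<in> lmeasurable"
    using assms by (intro lmeasurable_compact polyhedral_set_compact)
  ultimately show ?thesis
    by (metis measure_nonneg less_eq_real_def negligible_iff_measure)
qed

text \<open>The prisms of height 1 erected on the two sides of a face are translates of each other.\<close>

lemma face_measure_uminus: "face_measure (- n) S = face_measure n S"
proof -
  have "{x + s *\<^sub>R (- n) | x s. x \<in> S \<and> 0 \<le> s \<and> s \<le> 1}
    = (+) (- n) ` {x + s *\<^sub>R n | x s. x \<in> S \<and> 0 \<le> s \<and> s \<le> 1}" (is "?A = _ ` ?B")
  proof (intro equalityI subsetI)
    fix y assume "y \<in> ?A"
    then obtain x s where "y = x + s *\<^sub>R (- n)" "x \<in> S" "0 \<le> s" "s \<le> 1"
      by blast
    then have "y = - n + (x + (1 - s) *\<^sub>R n)" "x + (1 - s) *\<^sub>R n \<in> ?B"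
      by (auto simp: algebra_simps intro!: exI[of _ x] exI[of _ "1 - s"])
    then show "y \<in> (+) (- n) ` ?B"
      by blast
  next
    fix y assume "y \<in> (+) (- n) ` ?B"
    then obtain x s where "y = - n + (x + s *\<^sub>R n)" "x \<in> S" "0 \<le> s" "s \<le> 1"
      by blast
    then show "y \<in> ?A"
      by (auto simp: algebra_simps intro!: exI[of _ x] exI[of _ "1 - s"])
  qed
  then show ?thesis
    unfolding face_measure_def by (simp only: measure_translation)
qed


section \<open>Integration of cellwise constant functions\<close>

lemma has_integral_cellwise_constant:
  fixes cell :: "'c \<Rightarrow> 'a::euclidean_space set" and h :: "'c \<Rightarrow> real"
  assumes fin: "finite L"
    and meas: "\<And>l. l \<in> L \<Longrightarrow> cell l \<in> lmeasurable"
    and overlap: "\<And>l r. \<lbrakk>l \<in> L; r \<in> L; l \<noteq> r\<rbrakk> \<Longrightarrow> negligible (cell l \<inter> cell r)"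
  shows "((\<lambda>x. h (SOME l. l \<in> L \<and> x \<in> cell l)) has_integral
    (\<Sum>l\<in>L. measure lebesgue (cell l) * h l)) (\<Union>l\<in>L. cell l)"
proof (rule has_integral_UN[OF fin])
  fix l assume l: "l \<in> L"
  have "((\<lambda>x. 1::real) has_integral measure lebesgue (cell l)) (cell l)"
    using meas[OF l] by (simp add: lmeasure_integral lmeasurable_iff_integrable_on integrable_integral)
  then have const: "((\<lambda>x. h l) has_integral measure lebesgue (cell l) * h l) (cell l)"
    using has_integral_mult_left[of "\<lambda>x. 1::real" _ "cell l" "h l"] by simp
  \<comment> \<open>Off the points shared with other cells, the choice can only return \<open>l\<close>.\<close>
  have "negligible (\<Union>r\<in>L - {l}. cell l \<inter> cell r)"
    using fin l overlap by (intro negligible_Union) auto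
  then show "((\<lambda>x. h (SOME l. l \<in> L \<and> x \<in> cell l)) has_integral measure lebesgue (cell l) * h l) (cell l)"
  proof (rule has_integral_spike[OF _ _ const])
    fix x assume x: "x \<in> cell l - (\<Union>r\<in>L - {l}. cell l \<inter> cell r)"
    then have "(SOME l. l \<in> L \<and> x \<in> cell l) = l"
      using l by (intro some_equality) auto
    then show "h (SOME l. l \<in> L \<and> x \<in> cell l) = h l"
      by simp
  qed
next
  show "pairwise (\<lambda>l r. negligible (cell l \<inter> cell r)) L"
    using overlap by (simp add: pairwise_def)
qed

text \<open>The cells are only known to have disjoint interiors, so a common point lies on the frontier of
  one of the two.\<close>

lemma (in polyhedral_mesh) negligible_cell_overlap:
  assumes "l \<in> L" "r \<in> L" "l \<noteq> r"
  shows "negligible (cell l \<inter> cell r)"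
proof (rule negligible_subset)
  show "negligible (frontier (cell l) \<union> frontier (cell r))"
    using assms by (intro negligible_Un polyhedral_set_negligible_frontier[OF cell_polyhedral])
  show "cell l \<inter> cell r \<subseteq> frontier (cell l) \<union> frontier (cell r)"
    using cells_disjoint[OF assms] closure_subset unfolding frontier_def by blast
qed


section \<open>The numerical energy flux\<close>

lemma energy_has_vector_derivative:
  assumes "(q has_vector_derivative q') (at t within T)"
  shows "((\<lambda>s. energy (q s)) has_vector_derivative dual_var (q t) \<bullet> q') (at t within T)"
proof -
  have "(energy has_derivative (\<lambda>h. h \<bullet> q t)) (at (q t) within q ` T)"
    using GDERIV_energy[of "q t"] unfolding gderiv_def by (rule has_derivative_at_withinI)
  from vector_derivative_diff_chain_within[OF assms this] show ?thesis
    by (simp only: o_def dual_var_eq inner_commute[of q'])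
qed

text \<open>The work \<open>ql \<bullet> f\<close> is the mean work \<open>(ql + qr) \<bullet> f / 2\<close>, which the numerical energy flux contains,
  plus half the jump term \<open>(ql - qr) \<bullet> f\<close>, which the compatibility condition evaluates. The
  physical fluxes at \<open>qr\<close> enter the two with opposite signs and cancel.\<close>

lemma compatible_flux_work:
  assumes "dual_var ql \<bullet> (f - normal_flux c0 ch dir n ql)
      + dual_var qr \<bullet> (normal_flux c0 ch dir n qr - f)
    = normal_energy_flux c0 ch dir n qr - normal_energy_flux c0 ch dir n ql"
  shows "dual_var ql \<bullet> f = num_energy_flux c0 ch dir n ql qr f
    + (dual_var ql \<bullet> normal_flux c0 ch dir n ql - normal_energy_flux c0 ch dir n ql)"
  using assms unfolding num_energy_flux_def
  by (simp add: inner_diff_right inner_add_left field_simps)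

lemma normal_flux_uminus: "normal_flux c0 ch dir (- n) q = - normal_flux c0 ch dir n q"
  by (simp add: normal_flux_def sum_negf)

lemma normal_energy_flux_uminus:
  "normal_energy_flux c0 ch dir (- n) q = - normal_energy_flux c0 ch dir n q"
  by (simp add: normal_energy_flux_def sum_negf)

lemma num_energy_flux_antisym:
  "num_energy_flux c0 ch dir (- n) qr ql (- f) = - num_energy_flux c0 ch dir n ql qr f"
  by (simp add: num_energy_flux_def normal_flux_uminus normal_energy_flux_uminus
      inner_add_left field_simps)

text \<open>For a fixed state the summand is linear in the normal, so the sum is that linear form applied
  to the total area vector.\<close>

lemma closed_boundary_work_zero:
  fixes n :: "'c \<Rightarrow> real^'d::finite"
  assumes closed: "(\<Sum>r\<in>R. a r *\<^sub>R n r) = 0"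
  shows "(\<Sum>r\<in>R. a r * (p \<bullet> normal_flux c0 ch dir (n r) q - normal_energy_flux c0 ch dir (n r) q)) = 0"
proof -
  define w :: "real^'d" where
    "w = (\<chi> k. p \<bullet> flux c0 ch (dir k) q - energy_flux c0 ch (dir k) q)"
  have "p \<bullet> normal_flux c0 ch dir m q - normal_energy_flux c0 ch dir m q = m \<bullet> w" for m
    unfolding normal_flux_def normal_energy_flux_def w_def inner_vec_def[of m]
    by (simp add: inner_sum_right right_diff_distrib sum_subtractf)
  then have "(\<Sum>r\<in>R. a r * (p \<bullet> normal_flux c0 ch dir (n r) q - normal_energy_flux c0 ch dir (n r) q))
      = (\<Sum>r\<in>R. a r *\<^sub>R n r) \<bullet> w"
    by (simp add: inner_sum_left)
  with closed show ?thesis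
    by simp
qed


section \<open>Cancellation over the faces\<close>

text \<open>With \<open>a l r\<close> the total flux through the face between \<open>l\<close> and \<open>r\<close>, this is the telescoping of a
  conservative scheme. The double sum is its own negative when the order of summation is
  exchanged.\<close>

lemma sum_antisym_neighbours:
  fixes a :: "'c \<Rightarrow> 'c \<Rightarrow> real"
  assumes fin: "finite L" "\<And>l. l \<in> L \<Longrightarrow> finite (N l)"
    and sym: "\<And>l r. \<lbrakk>l \<in> L; r \<in> N l; r \<in> L\<rbrakk> \<Longrightarrow> l \<in> N r"
    and antisym: "\<And>l r. \<lbrakk>l \<in> L; r \<in> N l; r \<in> L\<rbrakk> \<Longrightarrow> a r l = - a l r"
    and boundary: "\<And>l r. \<lbrakk>l \<in> L; r \<in> N l; r \<notin> L\<rbrakk> \<Longrightarrow> a l r = 0"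
  shows "(\<Sum>l\<in>L. \<Sum>r\<in>N l. a l r) = 0"
proof -
  define b where "b l r = (if r \<in> N l then a l r else 0)" for l r
  have "(\<Sum>r\<in>N l. a l r) = (\<Sum>r\<in>L. b l r)" if l: "l \<in> L" for l
  proof -
    have "(\<Sum>r\<in>N l. a l r) = (\<Sum>r\<in>N l \<inter> L. a l r)"
      using fin l boundary by (intro sum.mono_neutral_right) auto
    also have "\<dots> = (\<Sum>r\<in>N l \<inter> L. b l r)"
      by (simp add: b_def)
    also have "\<dots> = (\<Sum>r\<in>L. b l r)"
      using fin by (intro sum.mono_neutral_left) (auto simp: b_def)
    finally show ?thesis .
  qed
  then have S: "(\<Sum>l\<in>L. \<Sum>r\<in>N l. a l r) = (\<Sum>l\<in>L. \<Sum>r\<in>L. b l r)"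
    by simp
  also have "\<dots> = (\<Sum>r\<in>L. \<Sum>l\<in>L. b l r)"
    by (rule sum.swap)
  also have "\<dots> = (\<Sum>r\<in>L. \<Sum>l\<in>L. - b r l)"
  proof (intro sum.cong refl)
    fix r l assume "r \<in> L" "l \<in> L"
    then show "b l r = - b r l"
      using sym[of l r] sym[of r l] antisym[of r l] by (auto simp: b_def)
  qed
  also have "\<dots> = - (\<Sum>l\<in>L. \<Sum>r\<in>L. b l r)"
    by (simp add: sum_negf)
  finally show ?thesis
    using S by simp
qed


section \<open>Conservation of the total energy\<close>

theorem theorem4p1:
  fixes c0 ch :: real
    and dir :: "'d::finite \<Rightarrow> 3"
    and \<Omega> :: "(real^'d) set"
    and L :: "'c set"
    and cell :: "'c \<Rightarrow> (real^'d) set"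
    and N :: "'c \<Rightarrow> 'c set"
    and face :: "'c \<Rightarrow> 'c \<Rightarrow> (real^'d) set"
    and normal :: "'c \<Rightarrow> 'c \<Rightarrow> real^'d"
    and T :: "real set"
    and q :: "'c \<Rightarrow> real \<Rightarrow> state"
    and fnum :: "'c \<Rightarrow> 'c \<Rightarrow> real \<Rightarrow> state"
  assumes "c0 > 0" and "ch > 0"
    and "inj dir"
    and mesh: "polyhedral_mesh \<Omega> L cell N face normal"
    and time: "is_interval T" "interior T \<noteq> {}"
    and single_valued: "\<And>l r t. \<lbrakk>l \<in> L; r \<in> N l; t \<in> T\<rbrakk> \<Longrightarrow> fnum r l t = - fnum l r t"
    and scheme: "\<And>l t. \<lbrakk>l \<in> L; t \<in> T\<rbrakk> \<Longrightarrow>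
      (q l has_vector_derivative
        - (\<Sum>r\<in>N l. (face_measure (normal l r) (face l r) / measure lebesgue (cell l)) *\<^sub>R fnum l r t))
      (at t within T)"
    and compatibility: "\<And>l r t. \<lbrakk>l \<in> L; r \<in> N l; t \<in> T\<rbrakk> \<Longrightarrow>
      dual_var (q l t) \<bullet> (fnum l r t - normal_flux c0 ch dir (normal l r) (q l t))
      + dual_var (q r t) \<bullet> (normal_flux c0 ch dir (normal l r) (q r t) - fnum l r t)
      = normal_energy_flux c0 ch dir (normal l r) (q r t)
        - normal_energy_flux c0 ch dir (normal l r) (q l t)"
    and vanishing_boundary: "\<And>l r t. \<lbrakk>l \<in> L; r \<in> N l; face l r \<subseteq> frontier \<Omega>; t \<in> T\<rbrakk> \<Longrightarrow>
      num_energy_flux c0 ch dir (normal l r) (q l t) (q r t) (fnum l r t) = 0"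
  shows "\<forall>t\<in>T.
    (\<forall>l\<in>L. (\<lambda>s. energy (q l s)) differentiable (at t within T)) \<and>
    ((\<lambda>x. vector_derivative (\<lambda>s. energy (cellwise L cell q s x)) (at t within T)) has_integral
      (\<Sum>l\<in>L. measure lebesgue (cell l) *
        vector_derivative (\<lambda>s. energy (q l s)) (at t within T))) \<Omega> \<and>
    (\<Sum>l\<in>L. measure lebesgue (cell l) *
        vector_derivative (\<lambda>s. energy (q l s)) (at t within T)) = 0"
proof
  fix t assume t: "t \<in> T"
  interpret polyhedral_mesh \<Omega> L cell N face normal
    by (fact mesh)
  define A where "A l r = face_measure (normal l r) (face l r)" for l r
  define V where "V l = measure lebesgue (cell l)" for l
  define F where
    "F l r = num_energy_flux c0 ch dir (normal l r) (q l t) (q r t) (fnum l r t)" for l r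
  define e' where "e' l = vector_derivative (\<lambda>s. energy (q l s)) (at t within T)" for l
  have V_pos: "0 < V l" if "l \<in> L" for l
    unfolding V_def using cell_polyhedral[OF that] by (intro polyhedral_set_measure_pos) simp

  have deriv: "((\<lambda>s. energy (q l s)) has_vector_derivative
      dual_var (q l t) \<bullet> - (\<Sum>r\<in>N l. (A l r / V l) *\<^sub>R fnum l r t)) (at t within T)"
    if "l \<in> L" for l
    using scheme[OF that t] unfolding A_def V_def by (rule energy_has_vector_derivative)

  \<comment> \<open>A nondegenerate interval has no isolated points, so derivatives within it are unique.\<close>
  have "at t within T \<noteq> bot"
  proof -
    have "connected T" "T \<noteq> {x}" for x
      using time by (auto simp: is_interval_connected)
    then show ?thesis
      using t connected_imp_perfect[of T t] by (simp add: trivial_limit_within)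
  qed
  then have e': "e' l = dual_var (q l t) \<bullet> - (\<Sum>r\<in>N l. (A l r / V l) *\<^sub>R fnum l r t)"
    if "l \<in> L" for l
    unfolding e'_def using deriv[OF that] by (rule vector_derivative_within)

  \<comment> \<open>The scheme induced for the energy.\<close>
  have balance: "V l * e' l = - (\<Sum>r\<in>N l. A l r * F l r)" if l: "l \<in> L" for l
  proof -
    have "V l * e' l = - (\<Sum>r\<in>N l. A l r * (dual_var (q l t) \<bullet> fnum l r t))"
      using V_pos[OF l] by (simp add: e'[OF l] inner_sum_right sum_distrib_left)
    also have "(\<Sum>r\<in>N l. A l r * (dual_var (q l t) \<bullet> fnum l r t))
      = (\<Sum>r\<in>N l. A l r * F l r)
        + (\<Sum>r\<in>N l. A l r * (dual_var (q l t) \<bullet> normal_flux c0 ch dir (normal l r) (q l t)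
            - normal_energy_flux c0 ch dir (normal l r) (q l t)))"
      using compatible_flux_work[OF compatibility[OF l _ t]]
      by (simp add: F_def ring_distribs flip: sum.distrib)
    also have "\<dots> = (\<Sum>r\<in>N l. A l r * F l r)"
      using closed_boundary_work_zero[OF boundary_closed[OF l]] by (simp add: A_def)
    finally show ?thesis .
  qed

  have "(\<Sum>l\<in>L. \<Sum>r\<in>N l. A l r * F l r) = 0"
  proof (rule sum_antisym_neighbours[OF finite_cells finite_neighbours neighbour_sym])
    fix l r assume lr: "l \<in> L" "r \<in> N l"
    have "A r l = A l r"
      unfolding A_def normal_antisym[OF lr] face_sym[OF lr] by (rule face_measure_uminus)
    moreover have "F r l = - F l r"
      unfolding F_def normal_antisym[OF lr] single_valued[OF lr t] by (rule num_energy_flux_antisym)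
    ultimately show "A r l * F r l = - (A l r * F l r)"
      by simp
  next
    fix l r assume lr: "l \<in> L" "r \<in> N l" "r \<notin> L"
    then have "F l r = 0"
      unfolding F_def using face_boundary[OF lr] t by (intro vanishing_boundary) auto
    then show "A l r * F l r = 0"
      by simp
  qed
  then have "(\<Sum>l\<in>L. V l * e' l) = 0"
    by (simp add: balance sum_negf)

  moreover have "((\<lambda>x. vector_derivative (\<lambda>s. energy (cellwise L cell q s x)) (at t within T))
      has_integral (\<Sum>l\<in>L. V l * e' l)) \<Omega>"
    unfolding cellwise_def V_def paving e'_def
    using finite_cells lmeasurable_compact[OF polyhedral_set_compact[OF cell_polyhedral]]
      negligible_cell_overlap
    by (rule has_integral_cellwise_constant)

  moreover have "\<forall>l\<in>L. (\<lambda>s. energy (q l s)) differentiable (at t within T)"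
    using deriv by (auto simp: has_vector_derivative_def differentiable_def)

  ultimately show "(\<forall>l\<in>L. (\<lambda>s. energy (q l s)) differentiable (at t within T)) \<and>
    ((\<lambda>x. vector_derivative (\<lambda>s. energy (cellwise L cell q s x)) (at t within T)) has_integral
      (\<Sum>l\<in>L. measure lebesgue (cell l) *
        vector_derivative (\<lambda>s. energy (q l s)) (at t within T))) \<Omega> \<and>
    (\<Sum>l\<in>L. measure lebesgue (cell l) *
        vector_derivative (\<lambda>s. energy (q l s)) (at t within T)) = 0"
    unfolding V_def e'_def by blast
qed

end
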